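(* Let $u,v$ be two inner functions in $\mathfrak I_c$. Then $uv\in\mathfrak I_c$.
   Context: $\mathbb D$ is the open unit disk. $\mathfrak I_c$ denotes the set of one-component inner functions: inner functions $u$ on $\mathbb D$ for which there is $\eta\in\,]0,1[$ such that the level set $\Omega_u(\eta)=\{z\in\mathbb D:|u(z)|<\eta\}$ is connected. *)

theory Defs
  imports "HOL-Complex_Analysis.Complex_Analysis"
begin

(* Radial limits suffice: for a bounded holomorphic function the radial and the
   nontangential limits exist and agree almost everywhere (Fatou).
   Unimodular constants are inner under this definition. *)
definition inner_function :: "(complex \<Rightarrow> complex) \<Rightarrow> bool" where
  "inner_function u \<longleftrightarrow>
     u holomorphic_on ball 0 1 \<and>
     (\<forall>z \<in> ball 0 1. norm (u z) \<le> 1) \<and>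
     (AE t in lebesgue_on {0..2 * pi}.
        \<exists>l. ((\<lambda>r. u (of_real r * cis t)) \<longlongrightarrow> l) (at_left (1::real)) \<and> norm l = 1)"

definition level_set :: "(complex \<Rightarrow> complex) \<Rightarrow> real \<Rightarrow> complex set" where
  "level_set u \<eta> = {z \<in> ball 0 1. norm (u z) < \<eta>}"

(* The empty set counts as connected, so unimodular constants belong to this set. *)
definition one_component_inner :: "(complex \<Rightarrow> complex) set" where
  "one_component_inner =
     {u. inner_function u \<and> (\<exists>\<eta>. 0 < \<eta> \<and> \<eta> < 1 \<and> connected (level_set u \<eta>))}"

end

theory Submission
  imports Defs
begin

text \<open>
  Write \<open>\<Omega>\<^sub>f(\<eta>)\<close> for the level set of \<open>f\<close>. Everything rests on one fact about an inner function \<open>f\<close>: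
  on every component of \<open>\<Omega>\<^sub>f(\<eta>)\<close> with \<open>\<eta> < 1\<close> the infimum of \<open>\<bar>f\<bar>\<close> is zero
  (\<open>component_of_level_set_reaches_zero\<close>).
  Granted this, if a connected set \<open>S\<close> satisfies
  \<open>\<Omega>\<^sub>f(\<delta>) \<subseteq> S \<subseteq> \<Omega>\<^sub>f(\<sigma>)\<close> for some \<open>\<delta> > 0\<close>, then each component of
  \<open>\<Omega>\<^sub>f(\<sigma>)\<close> meets \<open>S\<close> and so contains it, hence there is only one component
  (\<open>connected_level_setI\<close>).

  This criterion is used twice. With \<open>S = \<Omega>\<^sub>f(\<eta>)\<close> it shows that connectedness of a level set
  persists at all higher levels below 1. So a single level \<open>\<sigma>\<close> can be chosen at which
  the level sets of \<open>u\<close> and \<open>v\<close> are both connected and have a common point (or one of them is empty);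
  their union \<open>S\<close> is then connected, and the inclusions
  \<open>\<Omega>\<^sub>u\<^sub>v(\<sigma>\<^sup>2) \<subseteq> S \<subseteq> \<Omega>\<^sub>u\<^sub>v(\<sigma>)\<close> give the claim for the product.

  The fact itself is a maximum principle with an exceptional boundary set. If \<open>\<bar>f\<bar> \<ge> \<delta> > 0\<close> on a
  component \<open>C\<close>, then \<open>\<eta> / f\<close> is bounded and holomorphic there, has modulus larger than 1 in \<open>C\<close> and
  equal to 1 on the part of the boundary of \<open>C\<close> inside the disk. The rest of the boundary is
  negligible because \<open>f\<close> has unimodular radial limits almost everywhere: on circles of
  radius close to 1, the angles at which \<open>\<bar>f\<bar> \<le> \<eta>\<close> form a set of arbitrarily small measure
  (\<open>sublevel_set_small_on_some_circle\<close>). A finite sum of Herglotz kernels gives a holomorphic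
  function whose real part is at least 1 on that set, nonnegative on the disk, and small at a prescribed
  interior point (\<open>barrier_for_small_compact\<close>); multiplying \<open>\<eta> / f\<close> by the exponential of a negative
  multiple of it makes the ordinary maximum modulus principle applicable, and this forces
  \<open>\<bar>\<eta> / f\<bar> \<le> 1\<close> in \<open>C\<close>, a contradiction.
\<close>

section \<open>A holomorphic barrier for a small set of angles\<close>

text \<open>
  A compact set lies at positive distance from the complement of an open set of almost the same
  measure, so the cells of a fine grid that meet it stay inside that open set; being disjoint, they
  have total length bounded by its measure.
\<close>
lemma grid_cover_of_compact:
  fixes T :: "real set"
  assumes "compact T" and "measure lebesgue T < e"
  obtains s \<Theta> where "0 < s" "s \<le> 1" "finite \<Theta>" "\<And>t. t \<in> T \<Longrightarrow> \<exists>\<theta>\<in>\<Theta>. \<bar>t - \<theta>\<bar> \<le> s"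
    "real (card \<Theta>) * s \<le> e"
proof -
  have "T \<in> lmeasurable" using assms(1) by (rule lmeasurable_compact)
  then obtain U where U: "open U" "T \<subseteq> U" and D: "U - T \<in> lmeasurable"
    and "emeasure lebesgue (U - T) < ennreal (e - measure lebesgue T)"
    using sets_lebesgue_outer_open[of T "e - measure lebesgue T"] assms(2)
    by (auto dest: fmeasurableD)
  then have mD: "measure lebesgue (U - T) < e - measure lebesgue T"
    by (simp add: emeasure_eq_measure2 ennreal_less_iff)
  have "U = T \<union> (U - T)" using U by auto
  then have lU: "U \<in> lmeasurable" using D \<open>T \<in> lmeasurable\<close> by (metis fmeasurable.Un)
  have "measure lebesgue U = measure lebesgue T + measure lebesgue (U - T)"
    using U lU \<open>T \<in> lmeasurable\<close> by (simp add: measurable_measure_Diff fmeasurableD)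
  then have mU: "measure lebesgue U < e" using mD by simp
  have "\<exists>d>0. \<forall>x\<in>T. \<forall>y\<in>-U. d \<le> dist x y"
    using separate_compact_closed[OF assms(1), of "-U"] U by auto
  then obtain d where d: "d > 0" "\<And>x y. x \<in> T \<Longrightarrow> dist x y < d \<Longrightarrow> y \<in> U" 
    by (metis ComplI not_le)
  define s where "s = min 1 (d/2)"
  have s: "s > 0" "s \<le> 1" "s < d" using d(1) by (auto simp: s_def)
  \<comment> \<open>\<open>K\<close> indexes the grid cells that meet \<open>T\<close>; half-open cells are disjoint.\<close>
  define K where "K = (\<lambda>t. \<lfloor>t / s\<rfloor>) ` T"
  define I where "I = (\<lambda>k::int. {of_int k * s ..< (of_int k + 1) * s})"
  obtain b where b: "\<And>t. t \<in> T \<Longrightarrow> \<bar>t\<bar> \<le> b" 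
    using compact_imp_bounded[OF assms(1)] by (auto simp: bounded_iff)
  have "K \<subseteq> {\<lfloor>- b / s\<rfloor>..\<lfloor>b / s\<rfloor>}"
  proof
    fix k assume "k \<in> K"
    then obtain t where k: "k = \<lfloor>t / s\<rfloor>" and "t \<in> T" by (auto simp: K_def)
    then have "- b / s \<le> t / s" "t / s \<le> b / s"
      using b[of t] s(1) by (auto intro!: divide_right_mono simp del: divide_minus_left minus_divide_left)
    then show "k \<in> {\<lfloor>- b / s\<rfloor>..\<lfloor>b / s\<rfloor>}" unfolding k by (simp only: atLeastAtMost_iff floor_mono)
  qed
  then have fin: "finite K" using finite_subset by blast
  have mem: "t \<in> I \<lfloor>t / s\<rfloor>" for t
    using s(1) floor_divide_lower[of s t] floor_divide_upper[of s t] by (auto simp: I_def)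
  have sub: "(\<Union>k\<in>K. I k) \<subseteq> U"
  proof (clarsimp simp: K_def)
    fix t y assume "t \<in> T" "y \<in> I \<lfloor>t / s\<rfloor>"
    then have "\<bar>t - y\<bar> < s" using mem[of t] by (auto simp: I_def algebra_simps)
    then show "y \<in> U" using d(2)[of t y] \<open>t \<in> T\<close> s by (auto simp: dist_real_def)
  qed
  have disj: "disjoint_family_on I K"
    unfolding disjoint_family_on_def
  proof (intro ballI impI)
    fix m n :: int assume "m \<noteq> n"
    have fl: "\<lfloor>y / s\<rfloor> = k" if "y \<in> I k" for y k
      using that s(1) by (simp add: I_def floor_eq_iff field_simps)
    show "I m \<inter> I n = {}" using fl \<open>m \<noteq> n\<close> by blast
  qed
  have "real (card K) * s = (\<Sum>k\<in>K. measure lebesgue (I k))"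
    using s by (simp add: I_def algebra_simps)
  also have "\<dots> = measure lebesgue (\<Union>k\<in>K. I k)"
    by (rule measure_finite_Union[symmetric]) (use fin disj s(1) in \<open>auto simp: I_def algebra_simps\<close>)
  also have "\<dots> \<le> measure lebesgue U"
    by (rule measure_mono_fmeasurable[OF sub _ lU]) (auto simp: I_def intro!: sets.finite_UN fin)
  finally have cK: "real (card K) * s \<le> e" using mU by simp
  show ?thesis
  proof (rule that[of s "(\<lambda>k. of_int k * s) ` K"])
    show "\<exists>\<theta>\<in>(\<lambda>k. of_int k * s) ` K. \<bar>t - \<theta>\<bar> \<le> s" if "t \<in> T" for t
      using mem[of t] that s(1) unfolding K_def I_def
      by (intro bexI[of _ "of_int \<lfloor>t / s\<rfloor> * s"]) (auto simp: algebra_simps)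
    have "real (card ((\<lambda>k. of_int k * s) ` K)) * s \<le> real (card K) * s"
      using s card_image_le[OF fin] by (intro mult_right_mono) auto
    with cK show "real (card ((\<lambda>k. of_int k * s) ` K)) * s \<le> e" by linarith
  qed (use s fin in auto)
qed

text \<open>
  The real part is the Poisson kernel of the circle through \<open>p\<close>; for \<open>p\<close> outside the closed disk, the
  function \<open>(p + w) / (p - w)\<close> is thus holomorphic in \<open>w\<close> with positive real part there.
\<close>
lemma Re_herglotz_kernel:
  fixes p w :: complex
  assumes "p \<noteq> w"
  shows "Re ((p + w) / (p - w)) = ((norm p)\<^sup>2 - (norm w)\<^sup>2) / (norm (p - w))\<^sup>2"
proof -
  have "(p + w) / (p - w) = (p + w) * cnj (p - w) / of_real ((norm (p - w))\<^sup>2)"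
    by (metis complex_div_cnj)
  then have "Re ((p + w) / (p - w)) = Re ((p + w) * cnj (p - w)) / (norm (p - w))\<^sup>2"
    by (simp only: Re_divide_of_real)
  also have "Re ((p + w) * cnj (p - w)) = (norm p)\<^sup>2 - (norm w)\<^sup>2"
    by (simp add: cmod_power2) (simp add: algebra_simps power2_eq_square)
  finally show ?thesis .
qed

lemma norm_cis_diff_le: "norm (cis a - cis b) \<le> \<bar>a - b\<bar>"
proof -
  have "cis a - cis b = cis b * (cis (a - b) - 1)" by (simp add: algebra_simps cis_mult)
  then have "norm (cis a - cis b) = norm (exp (\<i> * of_real (a - b)) - 1)"
    by (simp add: norm_mult cis_conv_exp)
  also have "\<dots> = 2 * \<bar>sin ((a - b) / 2)\<bar>" by (rule dist_exp_i_1)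
  also have "\<dots> \<le> \<bar>a - b\<bar>" using abs_sin_x_le_abs_x[of "(a - b) / 2"] by simp
  finally show ?thesis .
qed

text \<open>
  This replaces the Poisson integral of the indicator function of \<open>T\<close>. For an arc of radius \<open>s\<close> about
  \<open>cis \<theta>\<close>, the Herglotz kernel with pole at \<open>(1 + s) cis \<theta>\<close> has real part at least \<open>1 / (2 s)\<close> on the arc,
  whereas it stays bounded at interior points as \<open>s\<close> tends to 0. Hence \<open>2 s\<close> times the kernel
  dominates the arc and costs only a multiple of its length inside; add this over a cover by short arcs.
\<close>
lemma barrier_for_small_compact:
  fixes T :: "real set"
  assumes "compact T" and "measure lebesgue T < e"
  shows "\<exists>G. G holomorphic_on ball 0 1 \<and> continuous_on (cball 0 1) G \<and>
    (\<forall>w\<in>cball 0 1. 0 \<le> Re (G w)) \<and> (\<forall>t\<in>T. 1 \<le> Re (G (cis t))) \<and>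
    (\<forall>w\<in>ball 0 1. Re (G w) \<le> 6 * e / (1 - norm w))"
proof -
  obtain s \<Theta> where s: "0 < s" "s \<le> 1" "finite \<Theta>" 
    and cov: "\<And>t. t \<in> T \<Longrightarrow> \<exists>\<theta>\<in>\<Theta>. \<bar>t - \<theta>\<bar> \<le> s"
    and card: "real (card \<Theta>) * s \<le> e"
    using grid_cover_of_compact[OF assms] by blast
  define p where "p \<theta> = of_real (1 + s) * cis \<theta>" for \<theta>
  define P where "P \<theta> w = (p \<theta> + w) / (p \<theta> - w)" for \<theta> w
  define G where "G w = (\<Sum>\<theta>\<in>\<Theta>. of_real (2 * s) * P \<theta> w)" for w
  have np: "norm (p \<theta>) = 1 + s" for \<theta> using s by (simp add: p_def norm_mult del: of_real_add)
  have ne: "p \<theta> \<noteq> w" if "norm w \<le> 1" for \<theta> w using that np[of \<theta>] s by auto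
  have hol: "G holomorphic_on cball 0 1"
    unfolding G_def P_def using ne by (intro holomorphic_intros) (auto simp: )
  have ReP: "Re (P \<theta> w) = ((1 + s)\<^sup>2 - (norm w)\<^sup>2) / (norm (p \<theta> - w))\<^sup>2" if "norm w \<le> 1" for \<theta> w
    unfolding P_def using Re_herglotz_kernel[OF ne[OF that]] np by simp
  have P0: "0 \<le> Re (P \<theta> w)" if "norm w \<le> 1" for \<theta> w
    unfolding ReP[OF that] using that s by (auto intro!: divide_nonneg_nonneg power_mono)
  have ReG: "Re (G w) = (\<Sum>\<theta>\<in>\<Theta>. 2 * s * Re (P \<theta> w))" for w
    by (simp add: G_def)
  show ?thesis
  proof (intro exI[of _ G] conjI ballI)
    show "G holomorphic_on ball 0 1" using hol by (rule holomorphic_on_subset) auto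
    show "continuous_on (cball 0 1) G" using hol by (rule holomorphic_on_imp_continuous_on)
    show "0 \<le> Re (G w)" if "w \<in> cball 0 1" for w
      unfolding ReG using P0[of w] that s by (intro sum_nonneg) auto
    show "1 \<le> Re (G (cis t))" if t: "t \<in> T" for t
    proof -
      obtain \<theta> where \<theta>: "\<theta> \<in> \<Theta>" "\<bar>t - \<theta>\<bar> \<le> s" using cov[OF t] by blast
      have "p \<theta> - cis t = of_real s * cis \<theta> + (cis \<theta> - cis t)" by (simp add: p_def algebra_simps)
      then have "norm (p \<theta> - cis t) \<le> norm (of_real s * cis \<theta>) + norm (cis \<theta> - cis t)"
        using norm_triangle_ineq by metis
      then have le: "norm (p \<theta> - cis t) \<le> 2 * s"
        using norm_cis_diff_le[of \<theta> t] \<theta> s by (simp add: norm_mult abs_minus_commute)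
      have pos: "norm (p \<theta> - cis t) > 0" using ne[of "cis t" \<theta>] by simp
      have "(norm (p \<theta> - cis t))\<^sup>2 \<le> (2 * s)\<^sup>2" using le by (intro power_mono) auto
      also have "\<dots> \<le> 2 * s * ((1 + s)\<^sup>2 - 1)" using s by (simp add: power2_eq_square algebra_simps)
      finally have "1 \<le> 2 * s * Re (P \<theta> (cis t))"
        using pos by (simp add: ReP divide_simps)
      also have "\<dots> \<le> Re (G (cis t))"
        unfolding ReG using P0 s \<theta> by (intro member_le_sum) auto
      finally show ?thesis .
    qed
    show "Re (G w) \<le> 6 * e / (1 - norm w)" if "w \<in> ball 0 1" for w
    proof -
      have w: "norm w < 1" using that by simp
      have "Re (P \<theta> w) \<le> 3 / (1 - norm w)" for \<theta>
      proof -
        have "Re (P \<theta> w) \<le> norm (p \<theta> + w) / norm (p \<theta> - w)"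
          using complex_Re_le_cmod[of "P \<theta> w"] by (simp add: P_def norm_divide)
        also have "\<dots> \<le> 3 / (1 - norm w)"
          using norm_triangle_ineq[of "p \<theta>" w] norm_triangle_ineq2[of "p \<theta>" w] np[of \<theta>] s w
          by (intro frac_le) auto
        finally show ?thesis .
      qed
      then have "Re (G w) \<le> (\<Sum>\<theta>\<in>\<Theta>. 2 * s * (3 / (1 - norm w)))"
        unfolding ReG using s by (intro sum_mono mult_left_mono) auto
      also have "\<dots> = 6 * (real (card \<Theta>) * s) / (1 - norm w)" by simp
      also have "\<dots> \<le> 6 * e / (1 - norm w)" using card w by (intro divide_right_mono mult_left_mono) auto
      finally show ?thesis .
    qed
  qed
qed

section \<open>Components of level sets of an inner function\<close>

text \<open>
  For almost every angle the modulus of \<open>f\<close> tends to 1 along the radius and finally exceeds \<open>\<eta>\<close>, so the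
  indicator functions of these sets converge to 0 almost everywhere as the radius tends to 1;
  dominated convergence makes their measures tend to 0.
\<close>
lemma sublevel_set_small_on_some_circle:
  assumes "inner_function f" "\<eta> < 1" "0 < e" "b < 1"
  obtains \<rho> where "0 < \<rho>" "b < \<rho>" "\<rho> < 1"
    "compact {t \<in> {0..2*pi}. norm (f (of_real \<rho> * cis t)) \<le> \<eta>}"
    "measure lebesgue {t \<in> {0..2*pi}. norm (f (of_real \<rho> * cis t)) \<le> \<eta>} < e"
proof -
  define r where "r n = 1 - inverse (real (Suc n))" for n
  define T where "T \<rho> = {t \<in> {0..2*pi}. norm (f (of_real \<rho> * cis t)) \<le> \<eta>}" for \<rho>
  have hol: "f holomorphic_on ball 0 1" using assms(1) by (simp add: inner_function_def)
  have comp: "compact (T \<rho>)" if "0 \<le> \<rho>" "\<rho> < 1" for \<rho>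
  proof -
    have "continuous_on {0..2*pi} (\<lambda>t. f (of_real \<rho> * cis t))"
      using that
      by (intro continuous_on_compose2[OF holomorphic_on_imp_continuous_on[OF hol]] continuous_intros)
        (auto simp: norm_mult)
    then have "closed ({0..2*pi} \<inter> (\<lambda>t. norm (f (of_real \<rho> * cis t))) -` {..\<eta>})"
      by (intro continuous_closed_preimage continuous_intros) auto
    moreover have "({0..2*pi} \<inter> (\<lambda>t. norm (f (of_real \<rho> * cis t))) -` {..\<eta>}) = T \<rho>" 
      by (auto simp: T_def)
    ultimately have "closed (T \<rho>)" by simp
    moreover have "bounded (T \<rho>)" by (rule bounded_subset[of "{0..2*pi}"]) (auto simp: T_def)
    ultimately show ?thesis by (simp add: compact_eq_bounded_closed)
  qed
  have r: "0 \<le> r n" "r n < 1" for n by (auto simp: r_def divide_simps)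
  have rlim: "filterlim r (at_left 1) sequentially"
    unfolding r_def by real_asymp
  have "(\<lambda>n. LINT t|lebesgue_on {0..2*pi}. indicator (T (r n)) t)
         \<longlonglongrightarrow> (LINT t|lebesgue_on {0..2*pi}. (0::real))"
  proof (rule integral_dominated_convergence[where w="\<lambda>_. 1"])
    show "AE t in lebesgue_on {0..2*pi}. (\<lambda>n. indicator (T (r n)) t) \<longlonglongrightarrow> (0::real)"
      using assms(1)[unfolded inner_function_def, THEN conjunct2, THEN conjunct2]
    proof eventually_elim
      case (elim t)
      then obtain l where l: "((\<lambda>r. f (of_real r * cis t)) \<longlongrightarrow> l) (at_left (1::real))" "norm l = 1" by blast
      have "((\<lambda>n. norm (f (of_real (r n) * cis t))) \<longlongrightarrow> 1) sequentially"
        using tendsto_norm[OF filterlim_compose[OF l(1) rlim]] l(2) by simp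
      then have "\<forall>\<^sub>F n in sequentially. norm (f (of_real (r n) * cis t)) > \<eta>"
        using assms(2) by (rule order_tendstoD)
      then have "\<forall>\<^sub>F n in sequentially. indicator (T (r n)) t = (0::real)"
        by eventually_elim (auto simp: T_def)
      then show ?case by (rule tendsto_eventually)
    qed
    have sT: "T (r n) \<in> sets (lebesgue_on {0..2*pi})" for n
      using lmeasurable_compact[OF comp[OF r]] 
      by (auto simp: sets_restrict_space_iff T_def fmeasurableD)
    show "indicat_real (T (r n)) \<in> borel_measurable (lebesgue_on {0..2*pi})" for n
      using sT by (intro borel_measurable_indicator) auto
    show "integrable (lebesgue_on {0..2*pi}) (\<lambda>_. 1::real)"
      by (simp add: integrable_restrict_space)
  qed (auto simp: indicator_def)
  moreover have "(LINT t|lebesgue_on {0..2*pi}. indicat_real (T (r n)) t) = measure lebesgue (T (r n))" for n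
  proof -
    have "T (r n) \<subseteq> {0..2*pi}" by (auto simp: T_def)
    then show ?thesis
      by (simp add: measure_restrict_space Int_absorb2 Int_absorb1)
  qed
  ultimately have "(\<lambda>n. measure lebesgue (T (r n))) \<longlonglongrightarrow> 0" by simp
  then have "\<forall>\<^sub>F n in sequentially. measure lebesgue (T (r n)) < e"
    using \<open>0 < e\<close> by (rule order_tendstoD)
  moreover have "\<forall>\<^sub>F n in sequentially. r n > max 0 b"
  proof -
    have "r \<longlonglongrightarrow> 1" unfolding r_def by real_asymp
    then show ?thesis by (rule order_tendstoD) (use assms in auto)
  qed
  ultimately have "\<forall>\<^sub>F n in sequentially. measure lebesgue (T (r n)) < e \<and> r n > max 0 b"
    by eventually_elim auto
  then obtain n where "measure lebesgue (T (r n)) < e" "r n > max 0 b"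
    using eventually_happens'[OF sequentially_bot] by blast
  then show ?thesis
    by (intro that[of "r n", folded T_def] comp r) auto
qed

text \<open>
  The maximum principle with exceptional set described at the beginning, applied on the intersection
  \<open>S\<close> of the component with a disk of radius \<open>\<rho> < 1\<close>. Its boundary lies on the boundary of \<open>C\<close>, where
  \<open>\<bar>f\<bar> = \<eta>\<close>, or on the circle of radius \<open>\<rho>\<close> at angles where \<open>\<bar>f\<bar> \<le> \<eta>\<close>; there the barrier \<open>G\<close> pays for the
  crude bound \<open>\<bar>\<eta> / f\<bar> \<le> \<eta> / \<delta>\<close>.
\<close>
lemma component_of_level_set_reaches_zero:
  assumes inner: "inner_function f" and \<eta>: "\<eta> < 1" and \<delta>: "0 < \<delta>"
    and C: "C \<in> components (level_set f \<eta>)"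
  shows "\<exists>z\<in>C. norm (f z) < \<delta>"
proof (rule ccontr)
  assume "\<not> ?thesis"
  then have low: "\<delta> \<le> norm (f z)" if "z \<in> C" for z using that by force
  have hol: "f holomorphic_on ball 0 1" using inner by (simp add: inner_function_def)
  then have cont: "continuous_on (ball 0 1) f" by (rule holomorphic_on_imp_continuous_on)
  have opL: "open (level_set f \<eta>)"
  proof -
    have "open (ball 0 1 \<inter> (\<lambda>z. norm (f z)) -` {..<\<eta>})"
      by (intro continuous_open_preimage continuous_intros cont) auto
    moreover have "ball 0 1 \<inter> (\<lambda>z. norm (f z)) -` {..<\<eta>} = level_set f \<eta>"
      by (auto simp: level_set_def)
    ultimately show ?thesis by simp
  qed
  have opC: "open C" using opL C by (rule open_components)
  have subC: "C \<subseteq> level_set f \<eta>" using C by (rule in_components_subset)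
  have cl: "\<delta> \<le> norm (f z) \<and> norm (f z) \<le> \<eta>" if z: "z \<in> closure C" "z \<in> ball 0 1" for z
  proof -
    have "isCont f z" using cont z(2) by (simp add: continuous_on_eq_continuous_at)
    then have t: "((\<lambda>z. norm (f z)) \<longlongrightarrow> norm (f z)) (at z within C)"
      by (intro tendsto_norm) (auto simp: isCont_def intro: tendsto_within_subset[of _ _ _ UNIV])
    show ?thesis
    proof (cases "z \<in> C")
      case True
      then show ?thesis using low subC by (force simp: level_set_def)
    next
      case False
      then have nb: "at z within C \<noteq> bot"
        using z(1) by (simp add: closure_def trivial_limit_within)
      have "\<forall>\<^sub>F w in at z within C. \<delta> \<le> norm (f w)" "\<forall>\<^sub>F w in at z within C. norm (f w) \<le> \<eta>"
        using low subC by (auto simp: eventually_at_filter level_set_def intro!: always_eventually less_imp_le)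
      then show ?thesis using tendsto_lowerbound[OF t _ nb] tendsto_upperbound[OF t _ nb] by blast
    qed
  qed
  have fr: "norm (f z) = \<eta>" if z: "z \<in> frontier C" "z \<in> ball 0 1" for z
  proof -
    have zc: "z \<in> closure C" "z \<notin> C" using z opC by (auto simp: frontier_def interior_open)
    have "\<not> norm (f z) < \<eta>"
    proof
      assume "norm (f z) < \<eta>"
      then have "z \<in> level_set f \<eta>" using z by (simp add: level_set_def)
      moreover have "C = level_set f \<eta> \<inter> closure C"
        using closedin_component[OF C] closure_minimal[of C] closure_subset[of C]
        unfolding closedin_closed by blast
      ultimately have "z \<in> C" using zc(1) by blast
      with zc show False by simp
    qed
    with cl[OF zc(1) z(2)] show ?thesis by simp
  qed
  obtain a where a: "a \<in> C" using in_components_nonempty[OF C] by auto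
  then have na: "norm a < 1" and fa: "norm (f a) < \<eta>" using subC by (auto simp: level_set_def)
  have fa0: "0 < norm (f a)" using low[OF a] \<delta> by linarith
  have \<eta>0: "0 < \<eta>" using fa fa0 by linarith
  define M where "M = ln (\<eta> / \<delta>)"
  define q where "q = ln (\<eta> / norm (f a))"
  have M: "0 < M" using low[OF a] \<delta> fa by (simp add: M_def)
  have q: "0 < q" unfolding q_def using fa fa0 by (intro ln_gt_zero) simp
  \<comment> \<open>Chosen so that the barrier term at \<open>a\<close>, at most \<open>M * (12 * e / (1 - norm a))\<close>, is \<open>q / 2\<close>.\<close>
  define e where "e = q * (1 - norm a) / (24 * M)"
  have e: "0 < e" using q M na by (simp add: e_def)
  \<comment> \<open>A radius above the midpoint of \<open>norm a\<close> and 1 keeps \<open>a / \<rho>\<close> away from the unit circle.\<close>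
  have half: "(1 + norm a) / 2 < 1" using na by simp
  obtain \<rho> where \<rho>: "0 < \<rho>" "(1 + norm a) / 2 < \<rho>" "\<rho> < 1" and
    comp: "compact {t \<in> {0..2*pi}. norm (f (of_real \<rho> * cis t)) \<le> \<eta>}" (is "compact ?T") and
    small: "measure lebesgue {t \<in> {0..2*pi}. norm (f (of_real \<rho> * cis t)) \<le> \<eta>} < e"
    by (rule sublevel_set_small_on_some_circle[OF inner \<eta> e half])
  obtain G where G: "G holomorphic_on ball 0 1" "continuous_on (cball 0 1) G"
    and G0: "\<forall>w\<in>cball 0 1. 0 \<le> Re (G w)" and G1: "\<forall>t\<in>?T. 1 \<le> Re (G (cis t))"
    and Ga: "\<forall>w\<in>ball 0 1. Re (G w) \<le> 6 * e / (1 - norm w)"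
    using barrier_for_small_compact[OF comp small] by blast
  define \<Phi> where "\<Phi> z = of_real \<eta> / f z * exp (- (of_real M * G (z / of_real \<rho>)))" for z
  have n\<Phi>: "norm (\<Phi> z) = \<eta> / norm (f z) * exp (- (M * Re (G (z / of_real \<rho>))))" for z
    using \<eta>0 by (simp add: \<Phi>_def norm_mult norm_divide)
  define S where "S = C \<inter> ball 0 \<rho>"
  have opS: "open S" unfolding S_def using opC open_ball by (rule open_Int)
  have clS: "closure S \<subseteq> closure C \<inter> cball 0 \<rho>"
    unfolding S_def by (intro Int_greatest closure_mono closure_minimal) auto
  have nz: "f z \<noteq> 0" if "z \<in> closure S" for z
    using cl[of z] that clS \<rho> \<delta> by fastforce
  have "norm (\<Phi> a) \<le> 1"
  proof (rule maximum_modulus_frontier[where S=S and f=\<Phi> and \<xi>=a])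
    show "\<Phi> holomorphic_on interior S"
      unfolding \<Phi>_def interior_open[OF opS]
    proof (intro holomorphic_intros)
      show "f holomorphic_on S" using hol by (rule holomorphic_on_subset) (use \<rho> in \<open>auto simp: S_def\<close>)
      have "(G \<circ> (\<lambda>z. z / of_real \<rho>)) holomorphic_on S"
        by (rule holomorphic_on_compose_gen[OF _ G(1)])
          (use \<rho> in \<open>auto intro!: holomorphic_intros simp: S_def norm_divide\<close>)
      then show "(\<lambda>z. G (z / of_real \<rho>)) holomorphic_on S" by (simp add: o_def)
      show "f z \<noteq> 0" if "z \<in> S" for z using nz closure_subset that by blast
    qed
    show "continuous_on (closure S) \<Phi>"
      unfolding \<Phi>_def
    proof (intro continuous_intros)
      show "continuous_on (closure S) f"
        using cont by (rule continuous_on_subset) (use clS \<rho> in fastforce)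
      show "continuous_on (closure S) (\<lambda>z. G (z / of_real \<rho>))"
        by (rule continuous_on_compose2[OF G(2)])
          (use clS \<rho> in \<open>fastforce intro!: continuous_intros simp: norm_divide\<close>)+
      show "\<forall>z\<in>closure S. f z \<noteq> 0" using nz by blast
    qed
    show "bounded S" by (simp add: S_def bounded_Int)
    show "a \<in> S" using a \<rho> na by (auto simp: S_def)
    show "norm (\<Phi> z) \<le> 1" if z: "z \<in> frontier S" for z
    proof -
      have zc: "z \<in> closure C" "norm z \<le> \<rho>" "z \<notin> S"
        using z clS opS by (auto simp: frontier_def interior_open)
      have zb: "z \<in> ball 0 1" using zc \<rho> by simp
      have c: "\<delta> \<le> norm (f z)" "norm (f z) \<le> \<eta>" using cl[OF zc(1) zb] by auto
      have g0: "0 \<le> Re (G (z / of_real \<rho>))" using zc \<rho> by (intro bspec[OF G0]) (simp add: norm_divide)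
      show ?thesis
      proof (cases "norm z = \<rho>")
        case True
        obtain t where t: "0 \<le> t" "t < 2 * pi" "z = of_real \<rho> * cis t"
          using complex_norm_eq_1_exp[of "z / of_real \<rho>"] True \<rho>
          by (metis Arg2pi_ge_0 Arg2pi_lt_2pi Arg2pi_eq cis_conv_exp)
        have "1 \<le> Re (G (z / of_real \<rho>))" using bspec[OF G1, of t] t c \<rho> by simp
        then have "exp (- (M * Re (G (z / of_real \<rho>)))) \<le> exp (- M)" using M by simp
        also have "\<dots> = \<delta> / \<eta>" using \<delta> c by (simp add: M_def exp_minus)
        finally have "norm (\<Phi> z) \<le> \<eta> / norm (f z) * (\<delta> / \<eta>)"
          unfolding n\<Phi> using \<delta> c by (intro mult_left_mono) auto
        also have "\<dots> \<le> 1" using \<delta> c by (simp add: divide_simps)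
        finally show ?thesis .
      next
        case False
        then have "z \<in> frontier C" using zc opC by (auto simp: S_def frontier_def interior_open)
        then have "norm (f z) = \<eta>" using fr zb by blast
        then show ?thesis unfolding n\<Phi> using g0 M \<delta> c by simp
      qed
    qed
  qed
  moreover have "\<eta> / norm (f a) = exp q" using fa0 \<eta>0 by (simp add: q_def)
  ultimately have "exp (q - M * Re (G (a / of_real \<rho>))) \<le> 1"
    by (simp add: n\<Phi> exp_add[symmetric])
  then have "q \<le> M * Re (G (a / of_real \<rho>))" by simp
  also have "\<dots> \<le> M * (12 * e / (1 - norm a))"
  proof (rule mult_left_mono)
    have lt: "norm (a / of_real \<rho>) < 1" using \<rho> na by (simp add: norm_divide)
    have "(1 - norm a) * \<rho> \<le> 2 * (\<rho> - norm a)"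
    proof -
      have "(1 - norm a) * \<rho> \<le> (1 - norm a) * 1" using \<rho> na by (intro mult_left_mono) auto
      also have "\<dots> \<le> 2 * (\<rho> - norm a)" using \<rho> by argo
      finally show ?thesis .
    qed
    then have "(1 - norm a) / 2 \<le> 1 - norm (a / of_real \<rho>)"
      using \<rho> by (simp add: norm_divide field_simps)
    then have "6 * e / (1 - norm (a / of_real \<rho>)) \<le> 6 * e / ((1 - norm a) / 2)"
      using e na by (intro divide_left_mono) auto
    then show "Re (G (a / of_real \<rho>)) \<le> 12 * e / (1 - norm a)"
      using bspec[OF Ga, of "a / of_real \<rho>"] lt by simp
  qed (use M in simp)
  also have "\<dots> = q / 2" using M na by (simp add: e_def field_simps)
  finally show False using q by simp
qed

section \<open>Connected level sets and products\<close>

text \<open>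
  Every component contains points where \<open>\<bar>f\<bar> < \<delta>\<close>, which lie in the connected set \<open>S\<close>; so every
  component contains \<open>S\<close>, and distinct components are disjoint.
\<close>
lemma connected_level_setI:
  assumes "inner_function f" "\<sigma> < 1" "0 < \<delta>" "connected S" 
    "level_set f \<delta> \<subseteq> S" "S \<subseteq> level_set f \<sigma>"
  shows "connected (level_set f \<sigma>)"
proof (cases "level_set f \<sigma> = {}")
  case False
  have "S \<noteq> {} \<and> S \<subseteq> C" if C: "C \<in> components (level_set f \<sigma>)" for C
  proof -
    obtain z where z: "z \<in> C" "norm (f z) < \<delta>"
      using component_of_level_set_reaches_zero assms C by blast
    then have "z \<in> S" using in_components_subset[OF C] assms(5) by (auto simp: level_set_def)
    then show ?thesis using components_maximal[OF C assms(4,6)] z by blast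
  qed
  then have "C = D" if "C \<in> components (level_set f \<sigma>)" "D \<in> components (level_set f \<sigma>)" for C D
    using components_eq[of C _ D] that by blast
  then show ?thesis unfolding connected_eq_components_subset_sing_exists by blast
qed simp

lemma level_set_mono: "\<eta> \<le> \<sigma> \<Longrightarrow> level_set f \<eta> \<subseteq> level_set f \<sigma>"
  by (auto simp: level_set_def)

lemma inner_function_mult:
  assumes "inner_function u" "inner_function v"
  shows "inner_function (\<lambda>z. u z * v z)"
  unfolding inner_function_def
proof (intro conjI ballI)
  show "(\<lambda>z. u z * v z) holomorphic_on ball 0 1"
    using assms by (auto simp: inner_function_def intro!: holomorphic_intros)
  show "norm (u z * v z) \<le> 1" if "z \<in> ball 0 1" for z
    using assms that by (auto simp: inner_function_def norm_mult intro!: mult_le_one)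
  have "AE t in lebesgue_on {0..2 * pi}.
        \<exists>l. ((\<lambda>r. u (of_real r * cis t)) \<longlongrightarrow> l) (at_left (1::real)) \<and> norm l = 1"
    "AE t in lebesgue_on {0..2 * pi}.
        \<exists>l. ((\<lambda>r. v (of_real r * cis t)) \<longlongrightarrow> l) (at_left (1::real)) \<and> norm l = 1"
    using assms by (auto simp: inner_function_def)
  then show "AE t in lebesgue_on {0..2 * pi}.
        \<exists>l. ((\<lambda>r. u (of_real r * cis t) * v (of_real r * cis t)) \<longlongrightarrow> l) (at_left (1::real)) \<and> norm l = 1"
  proof eventually_elim
    case (elim t)
    then obtain k l where "((\<lambda>r. u (of_real r * cis t)) \<longlongrightarrow> k) (at_left (1::real))" "norm k = 1"
      "((\<lambda>r. v (of_real r * cis t)) \<longlongrightarrow> l) (at_left (1::real))" "norm l = 1" by blast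
    then show ?case by (intro exI[of _ "k * l"]) (auto simp: norm_mult intro!: tendsto_mult)
  qed
qed

text \<open>
  By the maximum modulus principle: a modulus of 1 inside the disk would make \<open>v\<close> a unimodular constant.
\<close>
lemma norm_inner_less_1:
  assumes "inner_function v" "q \<in> ball 0 1" "norm (v q) < 1" "p \<in> ball 0 1"
  shows "norm (v p) < 1"
proof (rule ccontr)
  assume ge: "\<not> ?thesis"
  then have max: "norm (v z) \<le> norm (v p)" if "z \<in> ball 0 1" for z
    using assms that by (force simp: inner_function_def)
  have "v constant_on ball 0 1"
    by (rule maximum_modulus_principle[where U="ball 0 1" and \<xi>=p])
      (use assms max in \<open>auto simp: inner_function_def\<close>)
  then show False using assms ge by (auto simp: constant_on_def)
qed

theorem proposition2p9:
  fixes u v :: "complex \<Rightarrow> complex"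
  assumes "u \<in> one_component_inner" and "v \<in> one_component_inner"
  shows "(\<lambda>z. u z * v z) \<in> one_component_inner"
proof -
  obtain \<alpha> \<beta> where iu: "inner_function u" and \<alpha>: "0 < \<alpha>" "\<alpha> < 1" "connected (level_set u \<alpha>)"
    and iv: "inner_function v" and \<beta>: "0 < \<beta>" "\<beta> < 1" "connected (level_set v \<beta>)"
    using assms by (auto simp: one_component_inner_def)
  have cu: "connected (level_set u \<sigma>)" if "\<alpha> \<le> \<sigma>" "\<sigma> < 1" for \<sigma>
    using connected_level_setI[OF iu that(2) \<alpha>(1) \<alpha>(3)] level_set_mono[OF that(1)] by blast
  have cv: "connected (level_set v \<sigma>)" if "\<beta> \<le> \<sigma>" "\<sigma> < 1" for \<sigma>
    using connected_level_setI[OF iv that(2) \<beta>(1) \<beta>(3)] level_set_mono[OF that(1)] by blast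
  obtain \<sigma> where \<sigma>: "0 < \<sigma>" "\<sigma> < 1" and con: "connected (level_set u \<sigma> \<union> level_set v \<sigma>)"
  proof (cases "\<exists>p q. p \<in> ball 0 1 \<and> q \<in> ball 0 1 \<and> norm (u p) < 1 \<and> norm (v q) < 1")
    \<comment> \<open>Raising the level above both moduli at one point \<open>p\<close> makes the two level sets intersect.\<close>
    case True
    then obtain p where p: "p \<in> ball 0 1" "norm (u p) < 1" "norm (v p) < 1"
      using norm_inner_less_1[OF iv] by blast
    define m where "m = Max {\<alpha>, \<beta>, norm (u p), norm (v p)}"
    have m: "\<alpha> \<le> m" "\<beta> \<le> m" "norm (u p) \<le> m" "norm (v p) \<le> m" "m < 1"
      using p \<alpha> \<beta> by (auto simp: m_def)
    then obtain \<sigma> where "m < \<sigma>" "\<sigma> < 1" using dense by blast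
    with m p have "p \<in> level_set u \<sigma> \<inter> level_set v \<sigma>" by (auto simp: level_set_def)
    then have "connected (level_set u \<sigma> \<union> level_set v \<sigma>)"
      using cu[of \<sigma>] cv[of \<sigma>] m \<open>m < \<sigma>\<close> \<open>\<sigma> < 1\<close> by (intro connected_Un) auto
    then show ?thesis using that[of \<sigma>] m \<alpha> \<open>m < \<sigma>\<close> \<open>\<sigma> < 1\<close> by simp
  next
    \<comment> \<open>Otherwise one factor is unimodular throughout the disk and its level sets below level 1 are empty.\<close>
    case unimodular: False
    define \<sigma> where "\<sigma> = max \<alpha> \<beta>"
    have \<sigma>: "\<alpha> \<le> \<sigma>" "\<beta> \<le> \<sigma>" "\<sigma> < 1" using \<alpha> \<beta> by (auto simp: \<sigma>_def)
    then have "level_set u \<sigma> = {} \<or> level_set v \<sigma> = {}"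
      using unimodular by (fastforce simp: level_set_def)
    then have "connected (level_set u \<sigma> \<union> level_set v \<sigma>)"
      using cu[of \<sigma>] cv[of \<sigma>] \<sigma> by auto
    then show ?thesis using that[of \<sigma>] \<sigma> \<alpha> by simp
  qed
  let ?w = "\<lambda>z. u z * v z"
  have "level_set ?w (\<sigma>\<^sup>2) \<subseteq> level_set u \<sigma> \<union> level_set v \<sigma>"
  proof
    fix z assume z: "z \<in> level_set ?w (\<sigma>\<^sup>2)"
    show "z \<in> level_set u \<sigma> \<union> level_set v \<sigma>"
    proof (rule ccontr)
      assume "z \<notin> level_set u \<sigma> \<union> level_set v \<sigma>"
      then have "\<sigma> * \<sigma> \<le> norm (u z) * norm (v z)"
        using z \<sigma> by (intro mult_mono) (auto simp: level_set_def)
      then show False using z by (simp add: level_set_def norm_mult power2_eq_square)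
    qed
  qed
  moreover have "level_set u \<sigma> \<union> level_set v \<sigma> \<subseteq> level_set ?w \<sigma>"
  proof -
    have "norm (u z) * norm (v z) \<le> norm (u z)" "norm (u z) * norm (v z) \<le> norm (v z)"
      if "z \<in> ball 0 1" for z
      using iu iv that by (auto simp: inner_function_def intro: mult_left_le mult_left_le_one_le)
    then show ?thesis by (auto simp: level_set_def norm_mult dest: le_less_trans)
  qed
  ultimately have "connected (level_set ?w \<sigma>)"
    using connected_level_setI[OF inner_function_mult[OF iu iv] \<sigma>(2) _ con] \<sigma> by (meson zero_less_power)
  then show ?thesis
    unfolding one_component_inner_def using inner_function_mult[OF iu iv] \<sigma> by blast
qed

end
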